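(* As $D\to\infty$ over real numbers, $S(D)=\frac{\sqrt{3}}{2}D^2+O(D^{4/5})$. That is, there exist constants $C>0$ and $D_0>0$ such that for all real $D\ge D_0$, $$\left|S(D)-\frac{\sqrt{3}}{2}D^2\right|\le C\,D^{4/5}.$$
   Context: For a real number $D>0$, let $\mathcal{T}(D)$ be the set of all (non-degenerate) triangles with vertices in $\mathbb{Z}^2$, all side lengths at least $D$, and all angles at most $\pi/2$. Let $S(D)$ denote twice the smallest area of a triangle in $\mathcal{T}(D)$. *)

theory Defs
  imports "HOL-Analysis.Analysis"
begin

definition lattice_points :: "(real ^ 2) set"
  where "lattice_points = {p. \<forall>i. p $ i \<in> \<int>}"

(* The angle at the vertex b. If a = b or c = b this is the junk value arccos 0 = pi / 2. *)
definition angle_at :: "real ^ 2 \<Rightarrow> real ^ 2 \<Rightarrow> real ^ 2 \<Rightarrow> real"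
  where "angle_at a b c = arccos (((a - b) \<bullet> (c - b)) / (norm (a - b) * norm (c - b)))"

(* A triangle is represented by the ordered triple of its vertices. *)
definition nonobtuse_lattice_triangles :: "real \<Rightarrow> ((real ^ 2) \<times> (real ^ 2) \<times> (real ^ 2)) set"
  where "nonobtuse_lattice_triangles D = {(a, b, c).
    a \<in> lattice_points \<and> b \<in> lattice_points \<and> c \<in> lattice_points \<and>
    \<not> collinear {a, b, c} \<and>
    dist a b \<ge> D \<and> dist b c \<ge> D \<and> dist c a \<ge> D \<and>
    angle_at b a c \<le> pi / 2 \<and> angle_at a b c \<le> pi / 2 \<and> angle_at a c b \<le> pi / 2}"

definition triangle_area :: "(real ^ 2) \<times> (real ^ 2) \<times> (real ^ 2) \<Rightarrow> real"
  where "triangle_area = (\<lambda>(a, b, c). measure lborel (convex hull {a, b, c}))"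

(* The minimum is attained, see min_area_attained. *)
definition twice_min_area :: "real \<Rightarrow> real"
  where "twice_min_area D = 2 * (LEAST A. A \<in> triangle_area ` nonobtuse_lattice_triangles D)"

lemma nonobtuse_lattice_triangles_nonempty: "nonobtuse_lattice_triangles D \<noteq> {}"
proof -
  define N where "N = real (nat \<lceil>max D 1\<rceil>)"
  have N: "N \<ge> D" "N \<ge> 1" "N \<in> \<int>"
    unfolding N_def by linarith+ simp
  define a b c :: "real ^ 2" where abc: "a = 0" "b = N *\<^sub>R axis 1 1" "c = N *\<^sub>R axis 2 1"
  have comp: "a $ 1 = 0" "a $ 2 = 0" "b $ 1 = N" "b $ 2 = 0" "c $ 1 = 0" "c $ 2 = N"
    by (simp_all add: abc axis_def)
  have lat: "a \<in> lattice_points" "b \<in> lattice_points" "c \<in> lattice_points"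
    using comp N by (auto simp: lattice_points_def forall_2)
  have nab: "norm (b - a) = N" "norm (a - b) = N" "norm (c - a) = N" "norm (a - c) = N"
    using N comp by (auto simp: norm_vec_def L2_set_def sum_2)
  have nbc: "norm (b - c) \<ge> N" "norm (c - b) \<ge> N"
    using component_le_norm_cart[of "b - c" 1] component_le_norm_cart[of "c - b" 2] N comp
    by auto
  have arc: "arccos x \<le> pi / 2" if "0 \<le> x" "x \<le> 1" for x
    using arccos_le_pi2 that by auto
  have ang: "angle_at x y z \<le> pi / 2" if "(x - y) \<bullet> (z - y) \<ge> 0" for x y z :: "real ^ 2"
    unfolding angle_at_def
  proof (rule arc)
    show "0 \<le> (x - y) \<bullet> (z - y) / (norm (x - y) * norm (z - y))"
      using that by simp
    show "(x - y) \<bullet> (z - y) / (norm (x - y) * norm (z - y)) \<le> 1"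
      using norm_cauchy_schwarz[of "x - y" "z - y"] by (auto simp: divide_le_eq_1 zero_less_mult_iff)
  qed
  have "\<not> collinear {a, b, c}"
  proof
    assume "collinear {a, b, c}"
    then obtain u where u: "\<And>x y. x \<in> {a,b,c} \<Longrightarrow> y \<in> {a,b,c} \<Longrightarrow> \<exists>k. x - y = k *\<^sub>R u"
      unfolding collinear_def by blast
    obtain k l where k: "b - a = k *\<^sub>R u" and l: "c - a = l *\<^sub>R u" 
      using u by (metis insertCI)
    have "(b - a) $ 1 = k * u $ 1" "(b - a) $ 2 = k * u $ 2"
         "(c - a) $ 1 = l * u $ 1" "(c - a) $ 2 = l * u $ 2" 
      by (simp_all only: k l vector_scaleR_component real_scaleR_def)
    with comp N show False by auto
  qed
  moreover have "(b - a) \<bullet> (c - a) \<ge> 0" "(a - b) \<bullet> (c - b) \<ge> 0" "(a - c) \<bullet> (b - c) \<ge> 0"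
    using comp N by (auto simp: inner_vec_def sum_2)
  ultimately have "(a, b, c) \<in> nonobtuse_lattice_triangles D"
    unfolding nonobtuse_lattice_triangles_def dist_norm
    using lat nab nbc N(1) ang[of b a c] ang[of a b c] ang[of a c b] by simp
  then show ?thesis by auto
qed

lemma min_area_attained:
  obtains t where "t \<in> nonobtuse_lattice_triangles D" "twice_min_area D = 2 * triangle_area t"
    "\<And>t'. t' \<in> nonobtuse_lattice_triangles D \<Longrightarrow> triangle_area t \<le> triangle_area t'"
proof -
  let ?T = "nonobtuse_lattice_triangles D"
  have nat: "\<exists>n::nat. 2 * triangle_area t = real n" if "t \<in> ?T" for t
  proof -
    obtain a b c where t: "t = (a, b, c)" by (cases t)
    have "2 * triangle_area t =
      \<bar>(c $ 1 - a $ 1) * (b $ 2 - a $ 2) - (b $ 1 - a $ 1) * (c $ 2 - a $ 2)\<bar>"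
      by (simp add: t triangle_area_def content_triangle)
    moreover have "\<dots> \<in> \<int>"
      using that by (auto simp: t nonobtuse_lattice_triangles_def lattice_points_def)
    ultimately have "2 * triangle_area t \<in> \<nat>"
      by (simp add: Nats_altdef2)
    then show ?thesis by (auto elim: Nats_cases)
  qed
  define f where "f t = nat \<lfloor>2 * triangle_area t\<rfloor>" for t
  have f: "2 * triangle_area t = real (f t)" if "t \<in> ?T" for t
    using nat[OF that] by (auto simp: f_def)
  obtain t0 where "t0 \<in> ?T" using nonobtuse_lattice_triangles_nonempty by blast
  then obtain t where t: "t \<in> ?T" "\<And>t'. t' \<in> ?T \<Longrightarrow> f t \<le> f t'"
    using ex_has_least_nat[of "\<lambda>t. t \<in> ?T" t0 f] by blast
  have le: "triangle_area t \<le> triangle_area t'" if "t' \<in> ?T" for t'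
    using t(2)[OF that] f[OF that] f[OF t(1)] by linarith
  have "(LEAST A. A \<in> triangle_area ` ?T) = triangle_area t"
    using t(1) le by (intro Least_equality) auto
  then show thesis using that[OF t(1)] le by (simp add: twice_min_area_def)
qed

end

theory Submission
  imports Defs
begin

text \<open>
  A triangle that is equilateral with side \<open>D\<close> has twice the area \<open>sqrt 3 / 2 * D\<^sup>2\<close>, and no
  non-obtuse triangle with sides at least \<open>D\<close> does better. Twice the area of a triangle has square
  \<open>x * y + y * z + z * x\<close>, where \<open>x\<close>, \<open>y\<close>, \<open>z\<close> are the dot products of the edge vectors at the three
  vertices. These are nonnegative, and two of them add up to a squared side, so the lower bound
  (\<open>twice_min_area_ge\<close>) is an inequality about three nonnegative numbers with large pairwise sums.

  The upper bound needs a lattice triangle that is nearly equilateral and barely larger than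
  required. Turning the lattice vector \<open>(2 * x, 2 * y)\<close> by 60 degrees gives
  \<open>(x - sqrt 3 * y, sqrt 3 * x + y)\<close>. If \<open>sqrt 3 * x\<close> and \<open>sqrt 3 * y\<close> are within \<open>1 / Q\<close> of integers
  \<open>X\<close> and \<open>Y\<close>, then \<open>(x - Y, X + y)\<close> is a lattice point, and with a side of order \<open>D\<close> the rounding
  changes the squared sides and the area by \<open>O(D / Q)\<close> (\<open>equilateral_up_to_rounding\<close>). It remains to
  find such a pair with \<open>x\<^sup>2 + y\<^sup>2\<close> slightly above a prescribed \<open>R\<^sup>2\<close>, where \<open>R\<close> has order \<open>D\<close>.

  Integers \<open>n\<close> with \<open>sqrt 3 * n\<close> within \<open>1 / Q\<close> of an integer occur in every interval of length
  \<open>8 * Q\<close>, because \<open>sqrt 3\<close> has a rational approximation \<open>p / q\<close> with denominator of order \<open>Q\<close> and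
  error \<open>O(1 / Q\<^sup>2)\<close>, given by a solution of Pell's equation. Take such an \<open>x\<close> just below \<open>R\<close>,
  and then such a \<open>y\<close> just above \<open>sqrt (R\<^sup>2 - x\<^sup>2)\<close>, a number of size \<open>O(sqrt (Q * R))\<close>. Since the
  point is close to the horizontal axis, a step of length \<open>O(Q)\<close> in \<open>y\<close> moves \<open>x\<^sup>2 + y\<^sup>2\<close> by only
  \<open>O(Q * sqrt (Q * R))\<close>, apart from an \<open>O(Q\<^sup>2)\<close> term (\<open>lattice_point_outside_circle\<close>). The two errors
  \<open>D / Q\<close> and \<open>Q * sqrt (Q * D)\<close> balance at \<open>Q = D powr (1 / 5)\<close>, where both are \<open>D powr (4 / 5)\<close>.
\<close>

section \<open>The equilateral lower bound\<close>

text \<open>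
  The minimum is at \<open>x = y = z = s / 2\<close>. If the smallest of the three numbers, \<open>a\<close>, is less than
  \<open>s / 2\<close>, the other two are at least \<open>s - a\<close>, and \<open>(s - a)\<^sup>2 + 2 * a * (s - a) = s\<^sup>2 - a\<^sup>2\<close>, which
  exceeds \<open>3 / 4 * s\<^sup>2\<close>.
\<close>
lemma symmetric_sum_ge_of_pairwise_sums:
  fixes x y z s :: real
  assumes "0 \<le> x" "0 \<le> y" "0 \<le> z" "0 \<le> s" "s \<le> x + y" "s \<le> y + z" "s \<le> z + x"
  shows "3 / 4 * s\<^sup>2 \<le> x * y + y * z + z * x"
proof -
  have sorted: "3 / 4 * s\<^sup>2 \<le> a * b + b * c + c * a"
    if "0 \<le> a" "a \<le> b" "a \<le> c" "s \<le> a + b" "s \<le> a + c" for a b c :: real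
  proof (cases "a \<ge> s / 2")
    case True
    then have "(s/2) * (s/2) \<le> a * b" "(s/2) * (s/2) \<le> b * c" "(s/2) * (s/2) \<le> c * a"
      using that assms by (intro mult_mono; linarith)+
    then show ?thesis by (simp add: power2_eq_square)
  next
    case False
    have "(s - a) * (s - a) \<le> b * c" "a * (s - a) \<le> a * b" "a * (s - a) \<le> a * c"
      using that False assms by (intro mult_mono; linarith)+
    moreover have "a * (s / 2) \<le> s / 2 * (s / 2)" "a * a \<le> a * (s / 2)"
      using that False assms by (intro mult_mono; linarith)+
    ultimately show ?thesis
      using mult_nonneg_nonneg[of a "s - a"] sum_squares_ge_zero[of "s - 2*a" 0] that False assms
      by (simp add: algebra_simps power2_eq_square)
  qed
  show ?thesis
    using sorted[of x y z] sorted[of y z x] sorted[of z x y] assms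
    by (simp add: algebra_simps) linarith
qed

lemma angle_at_le_pi_half_iff:
  "angle_at a b c \<le> pi / 2 \<longleftrightarrow> 0 \<le> (a - b) \<bullet> (c - b)"
proof -
  let ?t = "(a - b) \<bullet> (c - b) / (norm (a - b) * norm (c - b))"
  have t: "\<bar>?t\<bar> \<le> 1"
    using Cauchy_Schwarz_ineq2[of "a - b" "c - b"] by (auto simp: divide_le_eq_1 zero_less_mult_iff)
  have "arccos ?t \<le> pi / 2 \<longleftrightarrow> 0 \<le> ?t"
    using arccos_le_mono[of ?t 0] t by (simp add: arccos_0)
  also have "\<dots> \<longleftrightarrow> 0 \<le> (a - b) \<bullet> (c - b)"
    by (cases "a = b \<or> c = b") (auto simp: zero_le_divide_iff mult_le_0_iff)
  finally show ?thesis by (simp add: angle_at_def)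
qed

text \<open>
  The determinant of two edge vectors, which unlike the measure of the convex hull is polynomial in
  the coordinates up to its sign.
\<close>
definition double_area :: "real ^ 2 \<Rightarrow> real ^ 2 \<Rightarrow> real ^ 2 \<Rightarrow> real"
  where "double_area a b c = \<bar>(c $ 1 - a $ 1) * (b $ 2 - a $ 2) - (b $ 1 - a $ 1) * (c $ 2 - a $ 2)\<bar>"

lemma double_area_eq: "double_area a b c = 2 * triangle_area (a, b, c)"
  by (simp add: double_area_def triangle_area_def content_triangle)

text \<open>
  Lagrange's identity \<open>det(u, v)\<^sup>2 = \<bar>u\<bar>\<^sup>2 * \<bar>v\<bar>\<^sup>2 - (u \<bullet> v)\<^sup>2\<close>, with the squared sides written as
  sums of two of the dot products at the vertices, turns the claim into
  \<open>symmetric_sum_ge_of_pairwise_sums\<close> for \<open>s = D\<^sup>2\<close>.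
\<close>
lemma double_area_ge:
  assumes "0 \<le> D" "D \<le> dist a b" "D \<le> dist b c" "D \<le> dist c a"
    and "0 \<le> (b - a) \<bullet> (c - a)" "0 \<le> (a - b) \<bullet> (c - b)" "0 \<le> (a - c) \<bullet> (b - c)"
  shows "sqrt 3 / 2 * D\<^sup>2 \<le> double_area a b c"
proof -
  let ?x = "(b - a) \<bullet> (c - a)" and ?y = "(a - b) \<bullet> (c - b)" and ?z = "(a - c) \<bullet> (b - c)"
  have side: "D\<^sup>2 \<le> (p - q) \<bullet> (p - q)" if "D \<le> dist p q" for p q :: "real ^ 2"
    using power_mono[OF that assms(1), of 2] by (simp add: dist_norm power2_norm_eq_inner)
  have "3 / 4 * (D\<^sup>2)\<^sup>2 \<le> ?x * ?y + ?y * ?z + ?z * ?x"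
  proof (rule symmetric_sum_ge_of_pairwise_sums)
    show "D\<^sup>2 \<le> ?x + ?y" "D\<^sup>2 \<le> ?y + ?z" "D\<^sup>2 \<le> ?z + ?x"
      using side[OF assms(2)] side[OF assms(3)] side[OF assms(4)]
      by (simp_all add: algebra_simps inner_commute)
  qed (use assms in auto)
  also have "\<dots> = (double_area a b c)\<^sup>2"
    by (simp add: double_area_def inner_vec_def sum_2) algebra
  finally have "(sqrt 3 / 2 * D\<^sup>2)\<^sup>2 \<le> (double_area a b c)\<^sup>2"
    by (simp add: power_mult_distrib power_divide)
  then show ?thesis
    by (rule power2_le_imp_le) (simp add: double_area_def)
qed

lemma double_area_eq_0_if_collinear:
  assumes "collinear {a, b, c}"
  shows "double_area a b c = 0"
proof -
  obtain u where u: "\<And>x y. x \<in> {a,b,c} \<Longrightarrow> y \<in> {a,b,c} \<Longrightarrow> \<exists>k. x - y = k *\<^sub>R u"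
    using assms unfolding collinear_def by blast
  obtain k l where k: "b - a = k *\<^sub>R u" and l: "c - a = l *\<^sub>R u"
    using u by (metis insertCI)
  have "b $ i - a $ i = k * u $ i" "c $ i - a $ i = l * u $ i" for i
    using k l by (metis vector_minus_component vector_scaleR_component real_scaleR_def)+
  then show ?thesis by (simp add: double_area_def)
qed

text \<open>
  The right-hand side entails non-collinearity, because \<open>double_area_ge\<close> makes the area positive.
\<close>
lemma mem_nonobtuse_lattice_triangles_iff:
  assumes "0 < D"
  shows "(a, b, c) \<in> nonobtuse_lattice_triangles D \<longleftrightarrow>
    a \<in> lattice_points \<and> b \<in> lattice_points \<and> c \<in> lattice_points \<and>
    D \<le> dist a b \<and> D \<le> dist b c \<and> D \<le> dist c a \<and>
    0 \<le> (b - a) \<bullet> (c - a) \<and> 0 \<le> (a - b) \<bullet> (c - b) \<and> 0 \<le> (a - c) \<bullet> (b - c)"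
proof -
  have "\<not> collinear {a, b, c}"
    if "D \<le> dist a b" "D \<le> dist b c" "D \<le> dist c a"
      "0 \<le> (b - a) \<bullet> (c - a)" "0 \<le> (a - b) \<bullet> (c - b)" "0 \<le> (a - c) \<bullet> (b - c)"
  proof -
    have "0 < sqrt 3 / 2 * D\<^sup>2" using assms by simp
    also have "\<dots> \<le> double_area a b c" using double_area_ge[of D a b c] assms that by simp
    finally show ?thesis using double_area_eq_0_if_collinear[of a b c] by auto
  qed
  then show ?thesis
    unfolding nonobtuse_lattice_triangles_def angle_at_le_pi_half_iff by auto
qed

lemma twice_min_area_ge:
  assumes "0 < D"
  shows "sqrt 3 / 2 * D\<^sup>2 \<le> twice_min_area D"
proof -
  obtain t where t: "t \<in> nonobtuse_lattice_triangles D" "twice_min_area D = 2 * triangle_area t"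
    by (rule min_area_attained)
  obtain a b c where "t = (a, b, c)" by (cases t)
  then show ?thesis
    using t double_area_ge[of D a b c] assms
    by (simp add: mem_nonobtuse_lattice_triangles_iff double_area_eq)
qed

lemma twice_min_area_le:
  assumes "(a, b, c) \<in> nonobtuse_lattice_triangles D"
  shows "twice_min_area D \<le> double_area a b c"
proof -
  obtain t where "twice_min_area D = 2 * triangle_area t"
    "\<And>t'. t' \<in> nonobtuse_lattice_triangles D \<Longrightarrow> triangle_area t \<le> triangle_area t'"
    by (rule min_area_attained) blast
  then show ?thesis using assms by (simp add: double_area_eq)
qed

section \<open>Integers whose multiple of the square root of 3 is nearly an integer\<close>

text \<open>
  The recursion \<open>(p, q) \<mapsto> (2 * p + 3 * q, p + 2 * q)\<close>, multiplication by the unit \<open>2 + sqrt 3\<close>, maps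
  solutions to solutions. As \<open>q < p \<le> 2 * q\<close>, it increases \<open>q\<close> by a factor of at most 4, so the
  solutions leave no gap larger than that.
\<close>
lemma pell_solution_of_size:
  fixes n :: int
  assumes "1 \<le> n"
  obtains p q :: int where "p\<^sup>2 = 3 * q\<^sup>2 + 1" "0 < p" "n \<le> q" "q \<le> 4 * n"
proof -
  have "\<exists>p q :: int. p\<^sup>2 = 3 * q\<^sup>2 + 1 \<and> 0 < p \<and> n \<le> q \<and> q \<le> 4 * n"
    using assms
  proof (induction n rule: int_ge_induct)
    case base
    show ?case by (rule exI[of _ 2], rule exI[of _ 1]) simp
  next
    case (step n)
    then obtain p q :: int where pq: "p\<^sup>2 = 3 * q\<^sup>2 + 1" "0 < p" "n \<le> q" "q \<le> 4 * n" by blast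
    show ?case
    proof (cases "n + 1 \<le> q")
      case True
      then show ?thesis using pq by force
    next
      case False
      then have q: "q = n" "1 \<le> q" using pq step by auto
      have "p\<^sup>2 \<le> (2 * q)\<^sup>2"
        using pq(1) one_le_power[of q 2] q by (simp add: power_mult_distrib)
      then have "p \<le> 2 * q" by (rule power2_le_imp_le) (use q in simp)
      moreover have "(2 * p + 3 * q)\<^sup>2 = 3 * (p + 2 * q)\<^sup>2 + 1"
        using pq(1) by algebra
      ultimately show ?thesis
        using pq(2) q by (intro exI[of _ "2 * p + 3 * q"] exI[of _ "p + 2 * q"]) auto
    qed
  qed
  then show thesis using that by blast
qed

text \<open>
  For a Pell solution the fractions \<open>j * p / q\<close> with \<open>0 \<le> j < q\<close> run modulo 1 through all multiples
  of \<open>1 / q\<close>, so one of them moves \<open>sqrt 3 * N\<close> to within \<open>1 / q\<close> above an integer, for any given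
  \<open>N\<close>. Replacing \<open>p / q\<close> by \<open>sqrt 3\<close> lowers the result by less than \<open>1 / q\<close>, because
  \<open>p - q * sqrt 3 = 1 / (p + q * sqrt 3)\<close>. The two errors have opposite signs, so they do not add up.
\<close>
lemma near_integer_multiple_of_sqrt_3:
  fixes M Q :: real
  assumes "1 \<le> Q"
  obtains n m :: real where "n \<in> \<int>" "m \<in> \<int>" "M \<le> n" "n \<le> M + 8 * Q" "\<bar>m - sqrt 3 * n\<bar> \<le> 1 / Q"
proof -
  obtain p q :: int where pell: "p\<^sup>2 = 3 * q\<^sup>2 + 1" and "0 < p" "\<lceil>Q\<rceil> \<le> q" "q \<le> 4 * \<lceil>Q\<rceil>"
    by (rule pell_solution_of_size[of "\<lceil>Q\<rceil>"]) (use assms in auto)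
  then have q: "Q \<le> q" "q \<le> 8 * Q" "0 < q"
    using assms by linarith+
  define N where "N = \<lceil>M\<rceil>"
  define r where "r = \<lfloor>q * (sqrt 3 * N)\<rfloor>"
  \<comment> \<open>Pell's equation gives \<open>p * p = 1\<close> modulo \<open>q\<close>, so \<open>p\<close> is its own inverse and this \<open>j\<close> solves
      \<open>r + j * p = 0\<close> modulo \<open>q\<close>.\<close>
  define j where "j = (- r * p) mod q"
  have j: "0 \<le> j" "j \<le> q - 1" using q by (auto simp: j_def)
  have "q dvd r + j * p"
  proof -
    obtain k where "j = - r * p + q * k"
      unfolding j_def by (metis mult.commute mult_div_mod_eq add.commute add_diff_cancel_left' minus_mult_right diff_conv_add_uminus)
    then have "r + j * p = q * (k * p - 3 * q * r)" using pell by algebra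
    then show ?thesis by simp
  qed
  then obtain m where m: "r + j * p = q * m" by blast
  have "(p - q * sqrt 3) * (p + q * sqrt 3) = 1"
  proof -
    have "(real_of_int p)\<^sup>2 = 3 * (real_of_int q)\<^sup>2 + 1"
      using pell by (metis of_int_1 of_int_add of_int_mult of_int_numeral of_int_power)
    then show ?thesis by (simp add: algebra_simps power2_eq_square)
  qed
  moreover have sum: "q \<le> p + q * sqrt 3"
  proof -
    have "real_of_int q * 1 \<le> q * sqrt 3" using q by (intro mult_left_mono) auto
    then show ?thesis using \<open>0 < p\<close> by simp
  qed
  ultimately have e: "0 < p - q * sqrt 3"
    using q by (metis less_le_trans of_int_0_less_iff zero_less_mult_pos2 zero_less_one)
  then have e1: "q * (p - q * sqrt 3) \<le> 1"
    using mult_left_mono[OF sum, of "p - q * sqrt 3"] \<open>(p - q * sqrt 3) * (p + q * sqrt 3) = 1\<close>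
    by (simp add: mult.commute)
  have "\<bar>m - sqrt 3 * (N + j)\<bar> \<le> 1 / q"
  proof -
    have "q * (m - sqrt 3 * (N + j)) = (r - q * (sqrt 3 * N)) + j * (p - q * sqrt 3)"
    proof -
      have "real_of_int r + j * p = q * m" using m by (metis of_int_add of_int_mult)
      then show ?thesis by (simp add: algebra_simps)
    qed
    moreover have "0 \<le> q * (sqrt 3 * N) - r" "q * (sqrt 3 * N) - r \<le> 1" unfolding r_def by linarith+
    moreover have "0 \<le> j * (p - q * sqrt 3)" using j e by simp
    moreover have "j * (p - q * sqrt 3) \<le> q * (p - q * sqrt 3)"
      using j e by (intro mult_right_mono) auto
    ultimately have "\<bar>q * (m - sqrt 3 * (N + j))\<bar> \<le> 1" using e1 by linarith
    then have "q * \<bar>m - sqrt 3 * (N + j)\<bar> \<le> 1" using q by (simp only: abs_mult abs_of_pos of_int_0_less_iff)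
    then show ?thesis using q by (simp add: pos_le_divide_eq mult.commute)
  qed
  also have "1 / q \<le> 1 / Q" using q assms by (simp add: frac_le)
  finally show thesis
    using that[of "of_int (N + j)" "of_int m"] j q unfolding N_def by (simp; linarith)
qed

section \<open>Nearly equilateral lattice triangles\<close>

text \<open>
  The triangle with vertices \<open>(0, 0)\<close>, \<open>(2 * x, 2 * y)\<close> and \<open>(x - Y, X + y)\<close> has squared sides \<open>4 * N\<close>
  and the two sums of squares below, and half its determinant is \<open>x * X + y * Y\<close>. With
  \<open>X = sqrt 3 * x\<close> and \<open>Y = sqrt 3 * y\<close> it would be equilateral; the rounding errors enter linearly
  with coefficients of size \<open>x + y\<close>, and otherwise only through their squares. Those squares increase
  the sides, so the lower bounds hold without the term \<open>2 * \<epsilon>\<^sup>2\<close>.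
\<close>
lemma equilateral_up_to_rounding:
  fixes x y X Y \<epsilon> :: real
  assumes nonneg: "0 \<le> x" "0 \<le> y"
    and X: "\<bar>X - sqrt 3 * x\<bar> \<le> \<epsilon>" and Y: "\<bar>Y - sqrt 3 * y\<bar> \<le> \<epsilon>"
  defines "N \<equiv> x\<^sup>2 + y\<^sup>2"
  shows "\<bar>(x - Y)\<^sup>2 + (X + y)\<^sup>2 - 4 * N\<bar> \<le> 6 * (\<epsilon> * (x + y)) + 2 * \<epsilon>\<^sup>2"
    and "\<bar>(x + Y)\<^sup>2 + (X - y)\<^sup>2 - 4 * N\<bar> \<le> 6 * (\<epsilon> * (x + y)) + 2 * \<epsilon>\<^sup>2"
    and "\<bar>x * X + y * Y\<bar> \<le> sqrt 3 * N + \<epsilon> * (x + y)"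
    and "4 * N \<le> (x - Y)\<^sup>2 + (X + y)\<^sup>2 + 6 * (\<epsilon> * (x + y))"
    and "4 * N \<le> (x + Y)\<^sup>2 + (X - y)\<^sup>2 + 6 * (\<epsilon> * (x + y))"
proof -
  define e f where "e = X - sqrt 3 * x" and "f = Y - sqrt 3 * y"
  have ef: "X = sqrt 3 * x + e" "Y = sqrt 3 * y + f" "\<bar>e\<bar> \<le> \<epsilon>" "\<bar>f\<bar> \<le> \<epsilon>"
    using X Y by (auto simp: e_def f_def)
  have bound: "\<bar>a * g\<bar> \<le> \<epsilon> * a" if "0 \<le> a" "\<bar>g\<bar> \<le> \<epsilon>" for a g :: real
    using that mult_left_mono[of "\<bar>g\<bar>" \<epsilon> a] by (simp add: abs_mult mult.commute)
  note bounds = bound[OF nonneg(1) ef(3)] bound[OF nonneg(1) ef(4)]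
    bound[OF nonneg(2) ef(3)] bound[OF nonneg(2) ef(4)]
  have linear: "\<bar>x * e + y * f\<bar> \<le> \<epsilon> * (x + y)" "\<bar>y * e - x * f\<bar> \<le> \<epsilon> * (x + y)"
    using bounds by (simp_all add: distrib_left)
  have "sqrt 3 \<le> 2" by (rule real_le_lsqrt) auto
  then have "\<bar>sqrt 3 * (x * e + y * f)\<bar> \<le> 2 * (\<epsilon> * (x + y))"
    using linear(1) unfolding abs_mult by (intro mult_mono) auto
  moreover have "e\<^sup>2 \<le> \<epsilon>\<^sup>2" "f\<^sup>2 \<le> \<epsilon>\<^sup>2"
    using ef(3,4) by (simp_all add: abs_le_square_iff[symmetric])
  moreover have sq: "(sqrt 3 * t + g)\<^sup>2 = 3 * t\<^sup>2 + 2 * (sqrt 3 * (t * g)) + g\<^sup>2" for t g :: real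
    by (simp add: power2_sum power_mult_distrib)
  have "(x - Y)\<^sup>2 + (X + y)\<^sup>2 =
      4 * N + 2 * (sqrt 3 * (x * e + y * f)) + 2 * (y * e - x * f) + e\<^sup>2 + f\<^sup>2"
    "(x + Y)\<^sup>2 + (X - y)\<^sup>2 =
      4 * N + 2 * (sqrt 3 * (x * e + y * f)) - 2 * (y * e - x * f) + e\<^sup>2 + f\<^sup>2"
    unfolding ef(1,2) N_def by (simp_all add: power2_sum power2_diff sq algebra_simps power_mult_distrib)
  ultimately show "\<bar>(x - Y)\<^sup>2 + (X + y)\<^sup>2 - 4 * N\<bar> \<le> 6 * (\<epsilon> * (x + y)) + 2 * \<epsilon>\<^sup>2"
    and "\<bar>(x + Y)\<^sup>2 + (X - y)\<^sup>2 - 4 * N\<bar> \<le> 6 * (\<epsilon> * (x + y)) + 2 * \<epsilon>\<^sup>2"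
    and "4 * N \<le> (x - Y)\<^sup>2 + (X + y)\<^sup>2 + 6 * (\<epsilon> * (x + y))"
    and "4 * N \<le> (x + Y)\<^sup>2 + (X - y)\<^sup>2 + 6 * (\<epsilon> * (x + y))"
    using linear(2) zero_le_power2[of e] zero_le_power2[of f] by (smt (verit))+
  have "x * X + y * Y = sqrt 3 * N + (x * e + y * f)"
    unfolding ef(1,2) N_def by (simp add: algebra_simps power2_eq_square)
  moreover have "0 \<le> sqrt 3 * N" by (simp add: N_def)
  ultimately show "\<bar>x * X + y * Y\<bar> \<le> sqrt 3 * N + \<epsilon> * (x + y)"
    using linear(1) by linarith
qed

text \<open>
  Choosing \<open>x\<close> within \<open>8 * Q\<close> of \<open>R\<close> makes \<open>R\<^sup>2 - x\<^sup>2\<close> at most \<open>16 * Q * R\<close>. The height \<open>w\<close> at which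
  the vertical line through \<open>x\<close> meets the circle is therefore small compared with \<open>R\<close>, and rounding
  it up by at most \<open>8 * Q\<close> costs only \<open>16 * Q * w + 64 * Q\<^sup>2\<close>.
\<close>
lemma lattice_point_outside_circle:
  fixes Q R :: real
  assumes Q: "1 \<le> Q" and R: "8 * Q \<le> R"
  obtains x y X Y :: real
  where "x \<in> \<int>" "y \<in> \<int>" "X \<in> \<int>" "Y \<in> \<int>" "0 \<le> x" "0 \<le> y" "x \<le> R" "y \<le> 4 * sqrt (Q * R) + 8 * Q"
    "\<bar>X - sqrt 3 * x\<bar> \<le> 1 / Q" "\<bar>Y - sqrt 3 * y\<bar> \<le> 1 / Q"
    "R\<^sup>2 \<le> x\<^sup>2 + y\<^sup>2" "x\<^sup>2 + y\<^sup>2 \<le> R\<^sup>2 + 64 * (Q * sqrt (Q * R)) + 64 * Q\<^sup>2"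
proof -
  obtain x X :: real where x_int: "x \<in> \<int>" "X \<in> \<int>" and x: "R - 8 * Q \<le> x" "x \<le> R" and X: "\<bar>X - sqrt 3 * x\<bar> \<le> 1 / Q"
    using near_integer_multiple_of_sqrt_3[OF Q, of "R - 8 * Q" thesis] by auto
  define w where "w = sqrt (R\<^sup>2 - x\<^sup>2)"
  have "0 \<le> x" using x R by linarith
  then have le: "x\<^sup>2 \<le> R\<^sup>2" using x by (intro power_mono) auto
  then have w: "0 \<le> w" "w\<^sup>2 = R\<^sup>2 - x\<^sup>2" by (auto simp: w_def)
  have "R\<^sup>2 - x\<^sup>2 = (R - x) * (R + x)" by (simp add: algebra_simps power2_eq_square)
  also have "\<dots> \<le> (8 * Q) * (2 * R)" using x \<open>0 \<le> x\<close> Q by (intro mult_mono) auto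
  finally have "w\<^sup>2 \<le> (4 * sqrt (Q * R))\<^sup>2" using Q R w by (simp add: power_mult_distrib)
  then have w_le: "w \<le> 4 * sqrt (Q * R)" by (rule power2_le_imp_le) (use Q R in simp)
  obtain y Y :: real where y_int: "y \<in> \<int>" "Y \<in> \<int>" and y: "w \<le> y" "y \<le> w + 8 * Q" and Y: "\<bar>Y - sqrt 3 * y\<bar> \<le> 1 / Q"
    by (rule near_integer_multiple_of_sqrt_3[OF Q])
  have "0 \<le> y" using y w by linarith
  have "w\<^sup>2 \<le> y\<^sup>2" using y w by (intro power_mono) auto
  moreover have "y\<^sup>2 \<le> (w + 8 * Q)\<^sup>2" using y \<open>0 \<le> y\<close> by (intro power_mono) auto
  moreover have "(w + 8 * Q)\<^sup>2 = w\<^sup>2 + 16 * (Q * w) + 64 * Q\<^sup>2"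
    by (simp add: power2_sum power_mult_distrib algebra_simps)
  moreover have "Q * w \<le> Q * (4 * sqrt (Q * R))" using w_le Q by (intro mult_left_mono) auto
  ultimately have "R\<^sup>2 \<le> x\<^sup>2 + y\<^sup>2" "x\<^sup>2 + y\<^sup>2 \<le> R\<^sup>2 + 64 * (Q * sqrt (Q * R)) + 64 * Q\<^sup>2"
    using w by simp_all
  then show thesis
    using that[of x y X Y] x_int y_int X Y x y w_le \<open>0 \<le> x\<close> \<open>0 \<le> y\<close> by simp
qed

text \<open>
  With \<open>D = Q ^ 5\<close>, all errors are of order \<open>Q ^ 4\<close>, which is small compared with \<open>D\<^sup>2 = Q ^ 10\<close>.
  Hence the squared sides lie between \<open>D\<^sup>2\<close> and \<open>2 * D\<^sup>2\<close>, and by the law of cosines this already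
  excludes an obtuse angle.
\<close>
lemma twice_min_area_upper_bound:
  fixes Q :: real
  assumes Q: "4 \<le> Q"
  shows "twice_min_area (Q ^ 5) \<le> sqrt 3 / 2 * (Q ^ 5)\<^sup>2 + 528 * Q ^ 4"
proof -
  define D where "D = Q ^ 5"
  \<comment> \<open>Rounding lowers a squared side by at most \<open>6 * (1 / Q) * (x + y)\<close>, and \<open>x + y \<le> 2 * D\<close>. The
      term \<open>12 * Q ^ 4\<close> compensates for this.\<close>
  define R where "R = sqrt (D\<^sup>2 + 12 * Q ^ 4) / 2"
  have pow: "Q ^ 4 * 1024 \<le> Q ^ 4 * Q ^ 6" "Q * 16 \<le> Q * Q ^ 4" "Q ^ 3 * 16 \<le> Q ^ 3 * Q\<^sup>2"
      "Q * 1 \<le> Q * Q\<^sup>2" "Q\<^sup>2 * 1 \<le> Q\<^sup>2 * Q\<^sup>2" "1 \<le> Q ^ 4"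
    using power_mono[OF Q, of 6] power_mono[OF Q, of 4] power_mono[OF Q, of 2] Q
    by (intro mult_left_mono; simp)+ (use power_mono[OF Q, of 4] in simp)
  have D2: "D\<^sup>2 = Q ^ 4 * Q ^ 6" unfolding D_def by (simp flip: power_add power_mult)
  have R2: "4 * R\<^sup>2 = D\<^sup>2 + 12 * Q ^ 4" using Q by (simp add: R_def power_divide)
  have "0 < D" using Q by (simp add: D_def)
  have "0 \<le> R" using Q by (simp add: R_def)
  have "D\<^sup>2 \<le> (2 * R)\<^sup>2" "R\<^sup>2 \<le> D\<^sup>2" using R2 D2 pow Q by (simp_all add: power_mult_distrib)
  then have "D \<le> 2 * R" "R \<le> D"
    using power2_le_imp_le[of D "2 * R"] power2_le_imp_le[of R D] \<open>0 \<le> R\<close> \<open>0 < D\<close> by simp_all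
  have "16 * Q \<le> D" using pow by (simp add: D_def power_eq_if)
  have root: "sqrt (Q * R) \<le> Q ^ 3"
  proof (rule real_le_lsqrt)
    have "Q * R \<le> Q * D" using \<open>R \<le> D\<close> Q by simp
    then show "Q * R \<le> (Q ^ 3)\<^sup>2" by (simp add: D_def power_eq_if)
  qed (use Q in simp)
  obtain x y X Y :: real where int: "x \<in> \<int>" "y \<in> \<int>" "X \<in> \<int>" "Y \<in> \<int>"
    and xy: "0 \<le> x" "0 \<le> y" "x \<le> R" "y \<le> 4 * sqrt (Q * R) + 8 * Q"
    and near: "\<bar>X - sqrt 3 * x\<bar> \<le> 1 / Q" "\<bar>Y - sqrt 3 * y\<bar> \<le> 1 / Q"
    and N: "R\<^sup>2 \<le> x\<^sup>2 + y\<^sup>2" "x\<^sup>2 + y\<^sup>2 \<le> R\<^sup>2 + 64 * (Q * sqrt (Q * R)) + 64 * Q\<^sup>2"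
    by (rule lattice_point_outside_circle[of Q R]) (use Q \<open>16 * Q \<le> D\<close> \<open>D \<le> 2 * R\<close> in auto)
  have "Q * sqrt (Q * R) \<le> Q * Q ^ 3" using root Q by (intro mult_left_mono) auto
  then have N_le: "x\<^sup>2 + y\<^sup>2 \<le> R\<^sup>2 + 128 * Q ^ 4"
    using N(2) pow by (simp add: power_eq_if)
  have "x + y \<le> 2 * D"
    using xy root pow \<open>R \<le> D\<close> by (simp add: D_def power_eq_if)
  then have "1 / Q * (x + y) \<le> 1 / Q * (2 * D)" using Q by (intro mult_left_mono) auto
  also have "\<dots> = 2 * Q ^ 4" using Q by (simp add: D_def power_eq_if)
  finally have linear: "1 / Q * (x + y) \<le> 2 * Q ^ 4" .
  have quadratic: "(1 / Q)\<^sup>2 \<le> Q ^ 4"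
    using pow(6) Q power_mono[of "1 / Q" 1 2] by (simp add: field_simps)
  note rounding = equilateral_up_to_rounding[OF xy(1,2) near]
  define a b c :: "real ^ 2" where "a = 0" and "b = vector [2 * x, 2 * y]" and "c = vector [x - Y, X + y]"
  have coords [simp]: "a $ 1 = 0" "a $ 2 = 0" "b $ 1 = 2 * x" "b $ 2 = 2 * y" "c $ 1 = x - Y" "c $ 2 = X + y"
    by (simp_all add: a_def b_def c_def vector_2)
  have lattice: "a \<in> lattice_points" "b \<in> lattice_points" "c \<in> lattice_points"
    using int by (auto simp: lattice_points_def forall_2)
  have sides: "(dist a b)\<^sup>2 = 4 * (x\<^sup>2 + y\<^sup>2)" "(dist b c)\<^sup>2 = (x + Y)\<^sup>2 + (X - y)\<^sup>2"
      "(dist c a)\<^sup>2 = (x - Y)\<^sup>2 + (X + y)\<^sup>2"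
    unfolding dist_norm power2_norm_eq_inner
    by (simp_all add: inner_vec_def sum_2 algebra_simps power2_eq_square)
  have ab: "4 * R\<^sup>2 \<le> (dist a b)\<^sup>2" "(dist a b)\<^sup>2 \<le> 4 * R\<^sup>2 + 512 * Q ^ 4"
    using N(1) N_le unfolding sides(1) by auto
  note others = rounding[folded sides] linear quadratic
  have lower: "D\<^sup>2 \<le> (dist a b)\<^sup>2" "D\<^sup>2 \<le> (dist b c)\<^sup>2" "D\<^sup>2 \<le> (dist c a)\<^sup>2"
    using ab others R2 pow(6) by (smt (verit))+
  have upper: "(dist a b)\<^sup>2 \<le> 2 * D\<^sup>2" "(dist b c)\<^sup>2 \<le> 2 * D\<^sup>2" "(dist c a)\<^sup>2 \<le> 2 * D\<^sup>2"
    using ab others R2 D2 pow(1,6) by (smt (verit))+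
  have cosine_law: "2 * ((p - q) \<bullet> (r - q)) = (dist p q)\<^sup>2 + (dist q r)\<^sup>2 - (dist r p)\<^sup>2"
    for p q r :: "real ^ 2"
    by (simp add: dist_norm power2_norm_eq_inner algebra_simps inner_commute)
  have "0 \<le> (b - a) \<bullet> (c - a)" "0 \<le> (a - b) \<bullet> (c - b)" "0 \<le> (a - c) \<bullet> (b - c)"
    using lower upper cosine_law[of b a c] cosine_law[of a b c] cosine_law[of a c b]
    by (simp_all add: dist_commute)
  moreover have "D \<le> dist a b" "D \<le> dist b c" "D \<le> dist c a"
    using lower by (auto intro: power2_le_imp_le)
  ultimately have "(a, b, c) \<in> nonobtuse_lattice_triangles D"
    using lattice \<open>0 < D\<close> by (simp add: mem_nonobtuse_lattice_triangles_iff)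
  then have "twice_min_area D \<le> double_area a b c" by (rule twice_min_area_le)
  also have "\<dots> = 2 * \<bar>x * X + y * Y\<bar>"
  proof -
    have "double_area a b c = \<bar>(- 2) * (x * X + y * Y)\<bar>"
      unfolding double_area_def coords by (rule arg_cong[where f = abs]) algebra
    then show ?thesis unfolding abs_mult by simp
  qed
  also have "\<dots> \<le> sqrt 3 / 2 * D\<^sup>2 + 528 * Q ^ 4"
  proof -
    have "sqrt 3 * (x\<^sup>2 + y\<^sup>2) \<le> sqrt 3 * (R\<^sup>2 + 128 * Q ^ 4)"
      using N_le by (intro mult_left_mono) auto
    also have "\<dots> = sqrt 3 / 4 * D\<^sup>2 + sqrt 3 * (131 * Q ^ 4)"
      using R2 by (simp add: field_simps)
    also have "\<dots> \<le> sqrt 3 / 4 * D\<^sup>2 + 2 * (131 * Q ^ 4)"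
    proof -
      have "sqrt 3 \<le> 2" by (rule real_le_lsqrt) auto
      then show ?thesis using Q by (intro add_left_mono mult_right_mono) auto
    qed
    finally have "\<bar>x * X + y * Y\<bar> \<le> sqrt 3 / 4 * D\<^sup>2 + 264 * Q ^ 4"
      using rounding(3) linear by linarith
    then show ?thesis by simp
  qed
  finally show ?thesis by (simp add: D_def)
qed

theorem theorem2:
  shows "\<exists>C > 0. \<exists>D0 > 0. \<forall>D :: real. D \<ge> D0 \<longrightarrow>
    \<bar>twice_min_area D - sqrt 3 / 2 * D\<^sup>2\<bar> \<le> C * D powr (4 / 5)"
proof (intro exI conjI allI impI)
  fix D :: real
  assume D: "1024 \<le> D"
  define Q where "Q = D powr (1 / 5)"
  have Q: "Q ^ 5 = D" "Q ^ 4 = D powr (4 / 5)" using D by (simp_all add: Q_def powr_power)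
  have "4 \<le> Q" by (rule power_le_imp_le_base[of _ 4]) (use Q D in \<open>simp_all add: Q_def\<close>)
  then show "\<bar>twice_min_area D - sqrt 3 / 2 * D\<^sup>2\<bar> \<le> 528 * D powr (4 / 5)"
    using twice_min_area_upper_bound[of Q] twice_min_area_ge[of D] D Q by simp
qed auto

end
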